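(* Let $m\geq 4$. Then: (1) the fibration $p\colon F_m(\mathbb{R}P^2)\to F_2(\mathbb{R}P^2)$, $p(x_1,\ldots,x_m)=(x_1,x_2)$, does not admit a cross-section; (2) the fibration $p\colon F_m(\mathbb{R}P^2)\to F_3(\mathbb{R}P^2)$, $p(x_1,\ldots,x_m)=(x_1,x_2,x_3)$, does not admit a cross-section, where in (2), for $m\geq 4$, the projection forgets the last $m-3$ points.
   Context: For a surface $M$ and $n\geq 1$, $F_n(M)=\{(p_1,\ldots,p_n)\in M^n \mid p_i\neq p_j \text{ if } i\neq j\}$ is the $n$th (ordered) configuration space of $M$. $\mathbb{R}P^2$ is the real projective plane. By Fadell and Neuwirth, for $m>n$ the projection $F_m(\mathbb{R}P^2)\to F_n(\mathbb{R}P^2)$ onto the first $n$ coordinates is a locally trivial fibration. A cross-section of $p$ is a continuous map $s$ from the base to the total space with $p\circ s=\mathrm{Id}$. *)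

theory Defs
  imports "HOL-Analysis.Analysis"
begin

definition quotient_topology :: "'a topology \<Rightarrow> ('a \<Rightarrow> 'b) \<Rightarrow> 'b topology" where
  "quotient_topology X q =
     topology (\<lambda>U. U \<subseteq> q ` topspace X \<and> openin X {x \<in> topspace X. q x \<in> U})"

lemma openin_quotient_topology:
  "openin (quotient_topology X q) U \<longleftrightarrow>
     U \<subseteq> q ` topspace X \<and> openin X {x \<in> topspace X. q x \<in> U}"
proof -
  have "istopology (\<lambda>U. U \<subseteq> q ` topspace X \<and> openin X {x \<in> topspace X. q x \<in> U})"
    unfolding istopology_def
  proof (rule conjI; intro allI impI)
    fix S T
    assume S: "S \<subseteq> q ` topspace X \<and> openin X {x \<in> topspace X. q x \<in> S}"
      and T: "T \<subseteq> q ` topspace X \<and> openin X {x \<in> topspace X. q x \<in> T}"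
    have "{x \<in> topspace X. q x \<in> S \<inter> T} =
          {x \<in> topspace X. q x \<in> S} \<inter> {x \<in> topspace X. q x \<in> T}"
      by auto
    then show "S \<inter> T \<subseteq> q ` topspace X \<and> openin X {x \<in> topspace X. q x \<in> S \<inter> T}"
      using S T by auto
  next
    fix K
    assume K: "\<forall>U\<in>K. U \<subseteq> q ` topspace X \<and> openin X {x \<in> topspace X. q x \<in> U}"
    have "{x \<in> topspace X. q x \<in> \<Union>K} = (\<Union>U\<in>K. {x \<in> topspace X. q x \<in> U})"
      by auto
    then show "\<Union>K \<subseteq> q ` topspace X \<and> openin X {x \<in> topspace X. q x \<in> \<Union>K}"
      using K by auto
  qed
  then show ?thesis
    by (simp add: quotient_topology_def topology_inverse')
qed

lemma topspace_quotient_topology [simp]: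
  "topspace (quotient_topology X q) = q ` topspace X"
proof
  show "topspace (quotient_topology X q) \<subseteq> q ` topspace X"
    using openin_quotient_topology[of X q "topspace (quotient_topology X q)"] by simp
next
  have "{x \<in> topspace X. q x \<in> q ` topspace X} = topspace X"
    by auto
  then have "openin (quotient_topology X q) (q ` topspace X)"
    by (simp add: openin_quotient_topology)
  then show "q ` topspace X \<subseteq> topspace (quotient_topology X q)"
    by (rule openin_subset)
qed

lemma quotient_map_quotient_topology: "quotient_map X (quotient_topology X q) q"
  by (simp add: quotient_map_def openin_quotient_topology)

text \<open>The real projective plane is the unit sphere of three-dimensional Euclidean space with
  antipodal points identified; its points are the sets \<open>{x, - x}\<close> with \<open>norm x = 1\<close>.\<close>

definition RP2 :: "(real ^ 3) set topology" where
  "RP2 = quotient_topology (top_of_set (sphere 0 1)) (\<lambda>x. {x, - x})"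

lemma topspace_RP2: "topspace RP2 = (\<lambda>x. {x, - x}) ` sphere 0 1"
  by (simp add: RP2_def)

text \<open>An \<open>n\<close>-tuple is a function on \<open>{1..n}\<close>, extended by \<open>undefined\<close> outside \<open>{1..n}\<close>
  as usual for \<open>product_topology\<close>.\<close>

definition config_space :: "nat \<Rightarrow> 'a topology \<Rightarrow> (nat \<Rightarrow> 'a) topology" where
  "config_space n M =
     subtopology (product_topology (\<lambda>_. M) {1..n})
       {x. \<forall>i\<in>{1..n}. \<forall>j\<in>{1..n}. i \<noteq> j \<longrightarrow> x i \<noteq> x j}"

lemma topspace_config_space:
  "topspace (config_space n M) =
     {x \<in> {1..n} \<rightarrow>\<^sub>E topspace M. \<forall>i\<in>{1..n}. \<forall>j\<in>{1..n}. i \<noteq> j \<longrightarrow> x i \<noteq> x j}"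
  by (auto simp: config_space_def)

definition config_proj :: "nat \<Rightarrow> (nat \<Rightarrow> 'a) \<Rightarrow> (nat \<Rightarrow> 'a)" where
  "config_proj n x = restrict x {1..n}"

lemma continuous_map_config_proj:
  assumes "n \<le> m"
  shows "continuous_map (config_space m M) (config_space n M) (config_proj n)"
proof -
  have "continuous_map (config_space m M) (product_topology (\<lambda>_. M) {1..n}) (config_proj n)"
    unfolding config_space_def
  proof (rule continuous_map_from_subtopology)
    show "continuous_map (product_topology (\<lambda>_. M) {1..m})
            (product_topology (\<lambda>_. M) {1..n}) (config_proj n)"
      using assms
      by (auto simp: continuous_map_componentwise config_proj_def
          intro!: continuous_map_product_projection)
  qed
  moreover have "config_proj n ` topspace (config_space m M) \<subseteq>
      {x. \<forall>i\<in>{1..n}. \<forall>j\<in>{1..n}. i \<noteq> j \<longrightarrow> x i \<noteq> x j}"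
    using assms by (auto simp: config_proj_def topspace_config_space)
  ultimately show ?thesis
    unfolding config_space_def[of n] continuous_map_in_subtopology by blast
qed

definition cross_section :: "'a topology \<Rightarrow> 'b topology \<Rightarrow> ('a \<Rightarrow> 'b) \<Rightarrow> ('b \<Rightarrow> 'a) \<Rightarrow> bool" where
  "cross_section E B p s \<longleftrightarrow> continuous_map B E s \<and> (\<forall>b\<in>topspace B. p (s b) = b)"

end

theory Submission
  imports Defs
begin

text \<open>
  A point of the three-sphere, read as a unit quaternion \<open>q\<close>, rotates the standard basis into an
  orthonormal frame \<open>e1, e2, e3\<close>. Right multiplication of \<open>q\<close> by the quaternions \<open>i\<close> and \<open>j\<close> only
  changes signs of frame vectors, so it fixes the lines that they span. A cross-section over
  pairs, or over triples, of distinct lines can be evaluated on these frame lines. Its third and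
  fourth components are then maps \<open>f, g\<close> from the three-sphere to the projective plane, invariant
  under \<open>q \<mapsto> q i\<close> and \<open>q \<mapsto> q j\<close>, such that \<open>f, g\<close> and the lines of \<open>e1, e2\<close> are pairwise distinct
  everywhere. Such \<open>f, g\<close> do not exist (lemma \<open>no_two_further_lines\<close>); this settles both fibrations.

  The obstruction comes from lemma \<open>common_zero\<close>. A real function \<open>u\<close> on the three-sphere may have a
  sign character: \<open>u (q i) = \<plusminus> u q\<close> and \<open>u (q j) = \<plusminus> u q\<close>. Two continuous functions whose characters
  are distinct and nontrivial have a common zero. (In cohomological terms: the product of two
  distinct nonzero classes in the first mod 2 cohomology of the quotient by the quaternion group of
  order 8 is nonzero.) The reason is that a nowhere zero pair is a map to the punctured plane; it
  has a continuous logarithm, and the relation \<open>i\<^sup>2 = j\<^sup>2\<close> forces incompatible periods on it.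

  This is used three times. Lift \<open>f\<close> to a map \<open>F\<close> into the unit sphere; then \<open>F\<close> itself has a sign
  character. Since \<open>f\<close> avoids the line of \<open>e1\<close>, the functions \<open>F \<bullet> e2\<close> and \<open>F \<bullet> e3\<close> have no common
  zero, so one of them has trivial character; since \<open>f\<close> avoids the line of \<open>e2\<close>, the same holds for
  \<open>F \<bullet> e1\<close> and \<open>F \<bullet> e3\<close>. Together this forces \<open>F (q i) = F (q j) = - F q\<close>, the behaviour of \<open>e3\<close>.
  The lift \<open>G\<close> of \<open>g\<close> has the same signs. Finally \<open>F \<times> G\<close> is nonzero and orthogonal to \<open>F\<close>, and its
  inner products with the vectors \<open>e1 \<times> F\<close> and \<open>F \<times> (e1 \<times> F)\<close>, which span the plane orthogonal to
  \<open>F\<close>, have distinct nontrivial characters and no common zero: a contradiction.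
\<close>

section \<open>Maps to the punctured plane\<close>

lemma continuous_exp_constant:
  fixes d :: "'a::topological_space \<Rightarrow> complex"
  assumes S: "connected S" and d: "continuous_on S d" and c: "\<And>q. q \<in> S \<Longrightarrow> exp (d q) = c"
  shows "\<exists>k. \<forall>q\<in>S. d q = k"
proof -
  have "d constant_on S"
  proof (rule continuous_discrete_range_constant[OF S d])
    fix x assume x: "x \<in> S"
    have "2 * pi \<le> norm (d y - d x)" if y: "y \<in> S" "d y \<noteq> d x" for y
    proof -
      from c[OF x] c[OF y(1)] obtain n :: int where n: "d y = d x + (of_int (2 * n) * pi) * \<i>"
        using exp_eq by metis
      have "n \<noteq> 0" using n y(2) by auto
      then have "1 \<le> \<bar>real_of_int n\<bar>" by linarith
      moreover have "norm (d y - d x) = 2 * pi * \<bar>real_of_int n\<bar>"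
        by (simp add: n norm_mult abs_mult)
      ultimately show ?thesis by simp
    qed
    then show "\<exists>e>0. \<forall>y. y \<in> S \<and> d y \<noteq> d x \<longrightarrow> e \<le> norm (d y - d x)"
      by (intro exI[of _ "2 * pi"]) auto
  qed
  then show ?thesis by (auto simp: constant_on_def)
qed

text \<open>
  Let \<open>w\<close> be a logarithm of \<open>h\<close>. The two symmetries of \<open>h\<close> say that \<open>w \<circ> \<sigma> - w\<close> and
  \<open>w \<circ> \<tau> - cnj \<circ> w\<close> are constants, an odd multiple of \<open>\<pi> \<i>\<close> and a multiple of \<open>2 \<pi> \<i>\<close>.
  Applying \<open>\<sigma>\<close> twice moves \<open>w\<close> by twice the first constant, while applying \<open>\<tau>\<close> twice returns \<open>w\<close> to
  itself, because conjugation negates the second constant. Hence \<open>\<sigma>\<^sup>2 = \<tau>\<^sup>2\<close> makes the odd multiple zero.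
\<close>

lemma no_antipodal_conjugate_map:
  fixes h :: "'a::real_normed_vector \<Rightarrow> complex"
  assumes S: "Borsukian S" "connected S" "S \<noteq> {}"
    and \<sigma>: "continuous_on S \<sigma>" "\<sigma> \<in> S \<rightarrow> S" and \<tau>: "continuous_on S \<tau>" "\<tau> \<in> S \<rightarrow> S"
    and square: "\<And>q. q \<in> S \<Longrightarrow> \<sigma> (\<sigma> q) = \<tau> (\<tau> q)"
    and h: "continuous_on S h" "\<And>q. q \<in> S \<Longrightarrow> h q \<noteq> 0"
    and h\<sigma>: "\<And>q. q \<in> S \<Longrightarrow> h (\<sigma> q) = - h q"
    and h\<tau>: "\<And>q. q \<in> S \<Longrightarrow> h (\<tau> q) = cnj (h q)"
  shows False
proof -
  obtain w where w: "continuous_on S w" "\<And>q. q \<in> S \<Longrightarrow> h q = exp (w q)"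
    using S(1) h unfolding Borsukian_continuous_logarithm by (metis Pi_I ComplI singletonD)
  have \<sigma>S: "\<sigma> q \<in> S" and \<tau>S: "\<tau> q \<in> S" if "q \<in> S" for q
    using that \<sigma>(2) \<tau>(2) by auto
  have cont: "continuous_on S (\<lambda>q. w (\<sigma> q))" "continuous_on S (\<lambda>q. w (\<tau> q))"
    using w(1) \<sigma> \<tau> by (auto intro!: continuous_on_compose2[OF w(1)])
  have "\<exists>a. \<forall>q\<in>S. w (\<sigma> q) - w q = a"
  proof (rule continuous_exp_constant[OF S(2)])
    show "continuous_on S (\<lambda>q. w (\<sigma> q) - w q)"
      by (intro continuous_intros cont w(1))
    show "exp (w (\<sigma> q) - w q) = -1" if "q \<in> S" for q
      using h\<sigma>[OF that] that \<sigma>S[OF that] by (simp add: exp_diff w(2))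
  qed
  then obtain a where a: "\<And>q. q \<in> S \<Longrightarrow> w (\<sigma> q) - w q = a"
    by blast
  have "\<exists>b. \<forall>q\<in>S. w (\<tau> q) - cnj (w q) = b"
  proof (rule continuous_exp_constant[OF S(2)])
    show "continuous_on S (\<lambda>q. w (\<tau> q) - cnj (w q))"
      by (intro continuous_intros cont w(1))
    show "exp (w (\<tau> q) - cnj (w q)) = 1" if "q \<in> S" for q
      using h\<tau>[OF that] that \<tau>S[OF that] by (simp add: exp_diff exp_cnj w(2))
  qed
  then obtain b where b: "\<And>q. q \<in> S \<Longrightarrow> w (\<tau> q) - cnj (w q) = b"
    by blast
  obtain q where q: "q \<in> S" using S(3) by blast
  have "exp b = 1"
    using h\<tau>[OF q] q \<tau>S[OF q] by (simp add: exp_diff exp_cnj w(2) flip: b[OF q])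
  then have "Re b = 0"
    by (metis exp_eq_1)
  have "w (\<sigma> (\<sigma> q)) = w q + 2 * a"
    using a[OF q] a[OF \<sigma>S[OF q]] by (simp add: algebra_simps)
  moreover have "w (\<tau> (\<tau> q)) = w q"
  proof -
    have "w (\<tau> q) = cnj (w q) + b" "w (\<tau> (\<tau> q)) = cnj (w (\<tau> q)) + b"
      using b[OF q] b[OF \<tau>S[OF q]] by (simp_all add: algebra_simps)
    then show ?thesis
      using \<open>Re b = 0\<close> by (simp add: complex_eq_iff)
  qed
  ultimately have "a = 0"
    using square[OF q] by simp
  then have "h (\<sigma> q) = h q"
    using a[OF q] q \<sigma>S[OF q] by (simp add: w(2))
  then show False
    using h\<sigma>[OF q] h(2)[OF q] by simp
qed

text \<open>
  This form fits the use with sign characters: two distinct nontrivial characters of a Klein four-group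
  are always both negative on some element \<open>\<sigma>\<close>, and some other element \<open>\<tau>\<close> separates them.
\<close>

lemma common_zero:
  fixes u v :: "'a::real_normed_vector \<Rightarrow> real"
  assumes S: "Borsukian S" "connected S" "S \<noteq> {}"
    and \<sigma>: "continuous_on S \<sigma>" "\<sigma> \<in> S \<rightarrow> S" and \<tau>: "continuous_on S \<tau>" "\<tau> \<in> S \<rightarrow> S"
    and square: "\<And>q. q \<in> S \<Longrightarrow> \<sigma> (\<sigma> q) = \<tau> (\<tau> q)"
    and uv: "continuous_on S u" "continuous_on S v"
    and u: "\<And>q. q \<in> S \<Longrightarrow> u (\<sigma> q) = - u q" "\<And>q. q \<in> S \<Longrightarrow> u (\<tau> q) = u q"
    and v: "\<And>q. q \<in> S \<Longrightarrow> v (\<sigma> q) = - v q" "\<And>q. q \<in> S \<Longrightarrow> v (\<tau> q) = - v q"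
  shows "\<exists>q\<in>S. u q = 0 \<and> v q = 0"
proof (rule ccontr)
  assume "\<not> ?thesis"
  then have nz: "Complex (u q) (v q) \<noteq> 0" if "q \<in> S" for q
    using that by (auto simp: complex_eq_iff)
  have cont: "continuous_on S (\<lambda>q. Complex (u q) (v q))"
    unfolding Complex_eq by (intro continuous_intros uv)
  show False
    by (rule no_antipodal_conjugate_map[OF S \<sigma> \<tau> _ cont])
      (use square nz u v in \<open>auto simp: complex_eq_iff\<close>)
qed

section \<open>Lifting maps from the projective plane to the sphere\<close>

text \<open>
  Orthogonal projection to the line through \<open>x\<close> and \<open>- x\<close>. Being quadratic in the unit vector \<open>x\<close>, it is
  insensitive to its sign, and so provides continuous vector-valued functions on the projective plane.
\<close>

definition line_proj :: "(real^3) set \<Rightarrow> real^3 \<Rightarrow> real^3" where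
  "line_proj l w = (let x = (SOME x. x \<in> l) in (x \<bullet> w) *\<^sub>R x)"

lemma line_proj_line: "line_proj {x, - x} w = (x \<bullet> w) *\<^sub>R x"
proof -
  have "(SOME y. y \<in> {x, - x}) \<in> {x, - x}"
    by (rule someI) auto
  then show ?thesis
    unfolding line_proj_def Let_def by auto
qed

lemma RP2_cases:
  assumes "l \<in> topspace RP2"
  obtains x where "norm x = 1" "l = {x, - x}"
  using assms by (auto simp: topspace_RP2)

lemma continuous_line_proj:
  fixes f :: "'a::topological_space \<Rightarrow> (real^3) set"
  assumes f: "continuous_map (top_of_set S) RP2 f" and w: "continuous_on S w"
  shows "continuous_on S (\<lambda>q. line_proj (f q) (w q))"
proof -
  have "continuous_map RP2 euclidean (\<lambda>l. line_proj l b)" for b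
  proof (rule continuous_compose_quotient_map)
    show "quotient_map (top_of_set (sphere 0 1)) RP2 (\<lambda>x. {x, - x})"
      unfolding RP2_def by (rule quotient_map_quotient_topology)
    show "continuous_map (top_of_set (sphere 0 1)) euclidean ((\<lambda>l. line_proj l b) \<circ> (\<lambda>x. {x, - x}))"
      by (auto simp: o_def line_proj_line intro!: continuous_intros)
  qed
  then have basis: "continuous_on S (\<lambda>q. line_proj (f q) b)" for b
    using continuous_map_compose[OF f, of euclidean "\<lambda>l. line_proj l b"] by (simp add: o_def)
  have "line_proj (f q) (w q) = (\<Sum>b\<in>Basis. (w q \<bullet> b) *\<^sub>R line_proj (f q) b)" if "q \<in> S" for q
  proof -
    have "f q \<in> topspace RP2"
      using continuous_map_funspace[OF f] that by auto
    then obtain x where x: "f q = {x, - x}"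
      by (rule RP2_cases)
    have "x \<bullet> w q = (\<Sum>b\<in>Basis. (w q \<bullet> b) * (x \<bullet> b))"
      by (subst euclidean_inner) (simp add: mult.commute)
    then show ?thesis
      by (simp add: x line_proj_line scaleR_sum_left)
  qed
  then show ?thesis
    by (subst continuous_on_cong[OF refl]) (auto intro!: continuous_intros basis w)
qed

text \<open>
  A vector \<open>x\<close> on the line \<open>f q\<close> has the complex coordinate \<open>x \<bullet> u + \<i> (x \<bullet> v)\<close>, determined up to
  sign and never zero. Its square is a continuous function of \<open>q\<close>, so it has a continuous square root
  \<open>r\<close>, and choosing a sign for \<open>r\<close> amounts to choosing one of the two unit vectors on each line.
\<close>

lemma lift_to_sphere:
  fixes f :: "'a::real_normed_vector \<Rightarrow> (real^3) set" and u v :: "'a \<Rightarrow> real^3"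
  assumes S: "Borsukian S" and f: "continuous_map (top_of_set S) RP2 f"
    and uv: "continuous_on S u" "continuous_on S v"
    and avoid: "\<And>q x. \<lbrakk>q \<in> S; x \<in> f q; x \<bullet> u q = 0; x \<bullet> v q = 0\<rbrakk> \<Longrightarrow> False"
  shows "\<exists>F. continuous_on S F \<and> (\<forall>q\<in>S. norm (F q) = 1 \<and> f q = {F q, - F q})"
proof -
  have line: "\<exists>x. norm x = 1 \<and> f q = {x, - x}" if "q \<in> S" for q
  proof -
    have "f q \<in> topspace RP2"
      using continuous_map_funspace[OF f] that by auto
    then show ?thesis
      by (rule RP2_cases) blast
  qed
  define z where "z q = Complex (line_proj (f q) (u q) \<bullet> u q - line_proj (f q) (v q) \<bullet> v q)
    (2 * (line_proj (f q) (u q) \<bullet> v q))" for q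
  have z: "z q = (Complex (x \<bullet> u q) (x \<bullet> v q))\<^sup>2" if "f q = {x, - x}" for q x
    by (simp add: z_def that line_proj_line complex_eq_iff power2_eq_square)
  have contz: "continuous_on S z"
    unfolding z_def Complex_eq by (intro continuous_intros continuous_line_proj f uv)
  have nz: "z q \<noteq> 0" if q: "q \<in> S" for q
  proof -
    obtain x where x: "f q = {x, - x}" using line[OF q] by blast
    then show ?thesis
      using avoid[OF q, of x] by (auto simp: z[OF x] Complex_eq_0)
  qed
  obtain g where g: "continuous_on S g" "\<And>q. q \<in> S \<Longrightarrow> z q = exp (g q)"
    using S contz nz unfolding Borsukian_continuous_logarithm by (metis Pi_I ComplI singletonD)
  define r where "r q = exp (g q / 2)" for q
  have r: "continuous_on S r" "\<And>q. q \<in> S \<Longrightarrow> (r q)\<^sup>2 = z q" "\<And>q. r q \<noteq> 0"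
    unfolding r_def by (auto intro!: continuous_intros g(1) simp: g(2) power2_eq_square simp flip: exp_add)
  \<comment> \<open>The unit vector on the line \<open>f q\<close> with coordinate \<open>r q\<close>, written so that it is visibly continuous.\<close>
  define F where "F q = (1 / (norm (r q))\<^sup>2) *\<^sub>R line_proj (f q) (Re (r q) *\<^sub>R u q + Im (r q) *\<^sub>R v q)" for q
  have F: "norm (F q) = 1 \<and> f q = {F q, - F q}" if q: "q \<in> S" for q
  proof -
    obtain x where x: "norm x = 1" "f q = {x, - x}" using line[OF q] by blast
    have "(r q)\<^sup>2 = (Complex (x \<bullet> u q) (x \<bullet> v q))\<^sup>2"
      using r(2)[OF q] z[OF x(2)] by simp
    then have "r q = Complex (x \<bullet> u q) (x \<bullet> v q) \<or> r q = - Complex (x \<bullet> u q) (x \<bullet> v q)"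
      by (simp only: power2_eq_iff)
    then have "r q = Complex (x \<bullet> u q) (x \<bullet> v q) \<or> r q = Complex ((- x) \<bullet> u q) ((- x) \<bullet> v q)"
      by (auto simp: complex_eq_iff)
    then obtain y where y: "norm y = 1" "f q = {y, - y}" "r q = Complex (y \<bullet> u q) (y \<bullet> v q)"
      using x that[of x] that[of "- x"] by (auto simp: insert_commute)
    have "y \<bullet> (Re (r q) *\<^sub>R u q + Im (r q) *\<^sub>R v q) = (norm (r q))\<^sup>2"
      by (simp add: y(3) cmod_power2 inner_add_right flip: power2_eq_square)
    then have "F q = y"
      using r(3)[of q] by (simp add: F_def y(2) line_proj_line)
    then show ?thesis using y by simp
  qed
  have "continuous_on S F"
    unfolding F_def by (intro continuous_intros continuous_line_proj f uv r(1)) (use r(3) in auto)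
  then show ?thesis using F by blast
qed

lemma lift_sign:
  fixes F :: "'a::topological_space \<Rightarrow> real^3"
  assumes S: "connected S" and F: "continuous_on S F" "\<And>q. q \<in> S \<Longrightarrow> norm (F q) = 1"
    and \<tau>: "continuous_on S \<tau>" "\<tau> \<in> S \<rightarrow> S"
    and sign: "\<And>q. q \<in> S \<Longrightarrow> F (\<tau> q) = F q \<or> F (\<tau> q) = - F q"
  shows "\<exists>c. (c = 1 \<or> c = -1) \<and> (\<forall>q\<in>S. F (\<tau> q) = c *\<^sub>R F q)"
proof -
  define d where "d q = F (\<tau> q) \<bullet> F q" for q
  have one: "F q \<bullet> F q = 1" if "q \<in> S" for q
    using F(2)[OF that] by (simp add: dot_square_norm)
  have d: "d q = 1 \<and> F (\<tau> q) = F q \<or> d q = -1 \<and> F (\<tau> q) = - F q" if "q \<in> S" for q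
    using sign[OF that] one[OF that] by (auto simp: d_def)
  have "continuous_on S d"
    unfolding d_def using \<tau>
    by (intro continuous_intros F(1) continuous_on_compose2[OF F(1) \<tau>(1)]) auto
  moreover have "finite (d ` S)"
    by (rule finite_subset[of _ "{1, -1}"]) (use d in auto)
  ultimately have "d constant_on S"
    by (rule continuous_finite_range_constant[OF S])
  then obtain c where c: "\<And>q. q \<in> S \<Longrightarrow> d q = c"
    by (auto simp: constant_on_def)
  show ?thesis
  proof (cases "S = {}")
    case True
    then show ?thesis by auto
  next
    case False
    then have "c = 1 \<or> c = -1" using c d by force
    moreover have "F (\<tau> q) = c *\<^sub>R F q" if "q \<in> S" for q
      using c[OF that] d[OF that] by auto
    ultimately show ?thesis by blast
  qed
qed

section \<open>The quaternion group acting on the three-sphere\<close>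

text \<open>
  The pair \<open>(z, w)\<close> stands for the quaternion \<open>z + w j\<close>. The maps \<open>qi\<close> and \<open>qj\<close> are right multiplication
  by \<open>i\<close> and \<open>j\<close>, and \<open>e1 q\<close>, \<open>e2 q\<close> are the first two columns of the rotation
  \<open>x \<mapsto> q x q\<^sup>-\<^sup>1\<close> of the imaginary quaternions.
\<close>

definition S3 :: "(complex \<times> complex) set" where "S3 = sphere 0 1"

definition qi :: "complex \<times> complex \<Rightarrow> complex \<times> complex" where
  "qi = (\<lambda>(z, w). (\<i> * z, - \<i> * w))"

definition qj :: "complex \<times> complex \<Rightarrow> complex \<times> complex" where
  "qj = (\<lambda>(z, w). (- w, z))"

definition e1 :: "complex \<times> complex \<Rightarrow> real^3" where
  "e1 = (\<lambda>(z, w). vector [(norm z)\<^sup>2 - (norm w)\<^sup>2, 2 * Im (z * w), - 2 * Re (z * w)])"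

definition e2 :: "complex \<times> complex \<Rightarrow> real^3" where
  "e2 = (\<lambda>(z, w). vector [- 2 * Im (cnj z * w), Re (z\<^sup>2 + w\<^sup>2), Im (z\<^sup>2 + w\<^sup>2)])"

definition e3 :: "complex \<times> complex \<Rightarrow> real^3" where
  "e3 q = cross3 (e1 q) (e2 q)"

lemma S3_iff: "(z, w) \<in> S3 \<longleftrightarrow> (Re z)\<^sup>2 + (Im z)\<^sup>2 + (Re w)\<^sup>2 + (Im w)\<^sup>2 = 1"
  by (simp add: S3_def norm_Pair cmod_power2 add.assoc)

lemma S3_topology: "Borsukian S3" "connected S3" "S3 \<noteq> {}"
  unfolding S3_def by (auto intro!: Borsukian_sphere connected_sphere)

lemma qi_qj_S3: "qi \<in> S3 \<rightarrow> S3" "qj \<in> S3 \<rightarrow> S3"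
  by (auto simp: qi_def qj_def S3_iff)

lemma qi_qj_continuous: "continuous_on A qi" "continuous_on A qj"
  unfolding qi_def qj_def case_prod_unfold by (intro continuous_intros)+

lemma qi_qj_square: "qi (qi q) = - q" "qj (qj q) = - q" "qj (qi (qj (qi q))) = - q"
  by (cases q; simp add: qi_def qj_def)+

lemma continuous_on_vector_3:
  fixes a b c :: "'a::topological_space \<Rightarrow> real"
  assumes "continuous_on S a" "continuous_on S b" "continuous_on S c"
  shows "continuous_on S (\<lambda>x. vector [a x, b x, c x] :: real^3)"
proof -
  have "(\<lambda>x. vector [a x, b x, c x] :: real^3) = (\<lambda>x. \<chi> i. if i = 1 then a x else if i = 2 then b x else c x)"
    by (auto simp: vec_eq_iff forall_3)
  moreover have "continuous_on S (\<lambda>x. if i = 1 then a x else if i = 2 then b x else c x)" for i :: 3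
    using assms by (cases "i = 1"; cases "i = 2") simp_all
  ultimately show ?thesis
    by (simp only: continuous_on_vec_lambda)
qed

lemma frame_continuous: "continuous_on A e1" "continuous_on A e2" "continuous_on A e3"
proof -
  show 1: "continuous_on A e1" and 2: "continuous_on A e2"
    unfolding e1_def e2_def case_prod_unfold by (intro continuous_on_vector_3 continuous_intros)+
  show "continuous_on A e3"
    unfolding e3_def by (intro continuous_on_cross 1 2)
qed

lemma frame_qi: "e1 (qi q) = e1 q" "e2 (qi q) = - e2 q" "e3 (qi q) = - e3 q"
proof -
  show 1: "e1 (qi q) = e1 q" and 2: "e2 (qi q) = - e2 q"
    by (cases q; simp add: e1_def e2_def qi_def vec_eq_iff forall_3 norm_mult power_mult_distrib algebra_simps)+
  show "e3 (qi q) = - e3 q"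
    by (simp add: e3_def 1 2)
qed

lemma frame_qj: "e1 (qj q) = - e1 q" "e2 (qj q) = e2 q" "e3 (qj q) = - e3 q"
proof -
  show 1: "e1 (qj q) = - e1 q" and 2: "e2 (qj q) = e2 q"
    by (cases q; simp add: e1_def e2_def qj_def vec_eq_iff forall_3 algebra_simps)+
  show "e3 (qj q) = - e3 q"
    by (simp add: e3_def 1 2)
qed

lemma frame_orthonormal:
  assumes "q \<in> S3"
  shows "norm (e1 q) = 1" "norm (e2 q) = 1" "norm (e3 q) = 1"
    "e1 q \<bullet> e2 q = 0" "e1 q \<bullet> e3 q = 0" "e2 q \<bullet> e3 q = 0"
proof -
  obtain z w where q: "q = (z, w)" by (cases q)
  obtain a b c d where zw: "z = Complex a b" "w = Complex c d" by (metis complex_surj)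
  have 1: "a\<^sup>2 + b\<^sup>2 + c\<^sup>2 + d\<^sup>2 = 1"
    using assms by (simp add: q zw S3_iff)
  have "e1 q \<bullet> e1 q = (a\<^sup>2 + b\<^sup>2 + c\<^sup>2 + d\<^sup>2)\<^sup>2" "e2 q \<bullet> e2 q = (a\<^sup>2 + b\<^sup>2 + c\<^sup>2 + d\<^sup>2)\<^sup>2"
    by (simp_all add: q zw e1_def e2_def inner_vec_def sum_3 cmod_power2 Re_power2 Im_power2) algebra+
  then show n: "norm (e1 q) = 1" "norm (e2 q) = 1"
    by (simp_all add: norm_eq_sqrt_inner 1)
  show o: "e1 q \<bullet> e2 q = 0"
    by (simp add: q zw e1_def e2_def inner_vec_def sum_3 cmod_power2 Re_power2 Im_power2) algebra
  show "e1 q \<bullet> e3 q = 0" "e2 q \<bullet> e3 q = 0"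
    by (simp_all add: e3_def dot_cross_self)
  show "norm (e3 q) = 1"
    using norm_cross[of "e1 q" "e2 q"] n o by (simp add: e3_def power2_eq_1_iff)
      (smt (verit) norm_ge_zero)
qed

lemma cross3_unit_eq_0:
  fixes x y :: "real^3"
  assumes "norm x = 1" "norm y = 1" "cross3 x y = 0"
  shows "x = y \<or> x = - y"
proof -
  have "(x \<bullet> y)\<^sup>2 = 1"
    using norm_cross_dot[of x y] assms by simp
  then have "x \<bullet> y = 1 \<or> (- x) \<bullet> y = 1"
    by (auto simp: power2_eq_1_iff)
  moreover have "x = y" if "x \<bullet> y = 1" "norm x = 1" for x :: "real^3"
    using that assms(2) by (subst vector_eq) (simp add: dot_square_norm)
  ultimately show ?thesis
    using assms(1) by (metis minus_equation_iff norm_minus_cancel)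
qed

lemma frame_determines_line:
  assumes q: "q \<in> S3" and x: "norm x = 1"
  shows "\<lbrakk>x \<bullet> e2 q = 0; x \<bullet> e3 q = 0\<rbrakk> \<Longrightarrow> {x, - x} = {e1 q, - e1 q}"
    and "\<lbrakk>x \<bullet> e1 q = 0; x \<bullet> e3 q = 0\<rbrakk> \<Longrightarrow> {x, - x} = {e2 q, - e2 q}"
proof -
  note on = frame_orthonormal[OF q]
  have on': "e1 q \<bullet> e1 q = 1" "e2 q \<bullet> e2 q = 1"
    using on by (simp_all add: dot_square_norm)
  {
    assume a: "x \<bullet> e2 q = 0" "x \<bullet> e3 q = 0"
    have "cross3 (e2 q) (e3 q) = e1 q"
      using on on' by (simp add: e3_def Lagrange inner_commute)
    then have "cross3 x (e1 q) = 0"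
      using a by (metis Lagrange diff_self scaleR_zero_left)
    then show "{x, - x} = {e1 q, - e1 q}"
      using cross3_unit_eq_0[OF x on(1)] by auto
  next
    assume a: "x \<bullet> e1 q = 0" "x \<bullet> e3 q = 0"
    have "cross3 (e1 q) (e3 q) = - e2 q"
      using on on' by (simp add: e3_def Lagrange inner_commute)
    then have "cross3 x (- e2 q) = 0"
      using a by (metis Lagrange diff_self scaleR_zero_left)
    then show "{x, - x} = {e2 q, - e2 q}"
      using cross3_unit_eq_0[OF x on(2)] by auto
  }
qed

text \<open>
  The signs of \<open>F\<close> under \<open>qi\<close> and \<open>qj\<close> are found by elimination. If \<open>F\<close> were invariant under \<open>qi\<close>, its
  coordinates along \<open>e2\<close> and \<open>e3\<close> would both be negated by \<open>qi\<close> and behave oppositely under \<open>qj\<close>, so they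
  would vanish together and \<open>f q\<close> would be the line of \<open>e1\<close>. With \<open>qi\<close> and \<open>qj\<close> exchanged, the
  coordinates along \<open>e1\<close> and \<open>e3\<close> exclude invariance under \<open>qj\<close>.
\<close>

lemma antisymmetric_lift:
  assumes f: "continuous_map (top_of_set S3) RP2 f"
    and f1: "\<And>q. q \<in> S3 \<Longrightarrow> f q \<noteq> {e1 q, - e1 q}"
    and f2: "\<And>q. q \<in> S3 \<Longrightarrow> f q \<noteq> {e2 q, - e2 q}"
    and inv: "\<And>q. q \<in> S3 \<Longrightarrow> f (qi q) = f q" "\<And>q. q \<in> S3 \<Longrightarrow> f (qj q) = f q"
  shows "\<exists>F. continuous_on S3 F \<and>
    (\<forall>q\<in>S3. norm (F q) = 1 \<and> f q = {F q, - F q} \<and> F (qi q) = - F q \<and> F (qj q) = - F q)"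
proof -
  note S = S3_topology
  have unit: "norm x = 1 \<and> f q = {x, - x}" if "q \<in> S3" "x \<in> f q" for q x
  proof -
    have "f q \<in> topspace RP2"
      using continuous_map_funspace[OF f] that(1) by auto
    then obtain y where y: "norm y = 1" "f q = {y, - y}"
      by (rule RP2_cases)
    then have "x = y \<or> x = - y"
      using that(2) by simp
    then show ?thesis
      using y by (elim disjE) (simp_all add: insert_commute)
  qed
  have "\<exists>F. continuous_on S3 F \<and> (\<forall>q\<in>S3. norm (F q) = 1 \<and> f q = {F q, - F q})"
  proof (rule lift_to_sphere[OF S(1) f frame_continuous(2,3)])
    show False if "q \<in> S3" "x \<in> f q" "x \<bullet> e2 q = 0" "x \<bullet> e3 q = 0" for q x
      using unit[OF that(1,2)] frame_determines_line(1)[OF that(1)] f1[OF that(1)] that(3,4) by metis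
  qed
  then obtain F where F: "continuous_on S3 F" "\<And>q. q \<in> S3 \<Longrightarrow> norm (F q) = 1"
    "\<And>q. q \<in> S3 \<Longrightarrow> f q = {F q, - F q}"
    by blast
  have inS: "qi q \<in> S3" "qj q \<in> S3" if "q \<in> S3" for q
    using that qi_qj_S3 by auto
  have "\<exists>c. (c = 1 \<or> c = -1) \<and> (\<forall>q\<in>S3. F (qi q) = c *\<^sub>R F q)"
  proof (rule lift_sign[OF S(2) F(1,2) qi_qj_continuous(1) qi_qj_S3(1)])
    show "F (qi q) = F q \<or> F (qi q) = - F q" if "q \<in> S3" for q
    proof -
      have "{F (qi q), - F (qi q)} = {F q, - F q}"
        by (metis F(3) inS(1) inv(1) that)
      then show ?thesis
        by (auto simp: doubleton_eq_iff)
    qed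
  qed
  then obtain a where a: "a = 1 \<or> a = -1" "\<And>q. q \<in> S3 \<Longrightarrow> F (qi q) = a *\<^sub>R F q"
    by blast
  have "\<exists>c. (c = 1 \<or> c = -1) \<and> (\<forall>q\<in>S3. F (qj q) = c *\<^sub>R F q)"
  proof (rule lift_sign[OF S(2) F(1,2) qi_qj_continuous(2) qi_qj_S3(2)])
    show "F (qj q) = F q \<or> F (qj q) = - F q" if "q \<in> S3" for q
    proof -
      have "{F (qj q), - F (qj q)} = {F q, - F q}"
        by (metis F(3) inS(2) inv(2) that)
      then show ?thesis
        by (auto simp: doubleton_eq_iff)
    qed
  qed
  then obtain b where b: "b = 1 \<or> b = -1" "\<And>q. q \<in> S3 \<Longrightarrow> F (qj q) = b *\<^sub>R F q"
    by blast
  have no_zero: "\<not> (F q \<bullet> e2 q = 0 \<and> F q \<bullet> e3 q = 0)" "\<not> (F q \<bullet> e1 q = 0 \<and> F q \<bullet> e3 q = 0)"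
    if "q \<in> S3" for q
    using frame_determines_line[OF that F(2)[OF that]] f1[OF that] f2[OF that] F(3)[OF that] by auto
  have cont: "continuous_on S3 (\<lambda>q. F q \<bullet> e1 q)" "continuous_on S3 (\<lambda>q. F q \<bullet> e2 q)"
    "continuous_on S3 (\<lambda>q. F q \<bullet> e3 q)"
    by (intro continuous_intros F(1) frame_continuous)+
  have "a = -1"
  proof (rule ccontr)
    assume "a \<noteq> -1"
    then have a1: "a = 1" using a(1) by simp
    have sq: "qi (qi q) = qj (qj q)" for q by (simp add: qi_qj_square)
    show False
    proof (cases "b = 1")
      case True
      have "\<exists>q\<in>S3. F q \<bullet> e2 q = 0 \<and> F q \<bullet> e3 q = 0"
        by (rule common_zero[OF S qi_qj_continuous(1) qi_qj_S3(1) qi_qj_continuous(2) qi_qj_S3(2) sq cont(2,3)])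
          (auto simp: a(2) b(2) a1 True frame_qi frame_qj)
      then show False using no_zero by blast
    next
      case False
      then have "b = -1" using b(1) by simp
      have "\<exists>q\<in>S3. F q \<bullet> e3 q = 0 \<and> F q \<bullet> e2 q = 0"
        by (rule common_zero[OF S qi_qj_continuous(1) qi_qj_S3(1) qi_qj_continuous(2) qi_qj_S3(2) sq cont(3,2)])
          (auto simp: a(2) b(2) a1 \<open>b = -1\<close> frame_qi frame_qj)
      then show False using no_zero by blast
    qed
  qed
  moreover have "b = -1"
  proof (rule ccontr)
    assume "b \<noteq> -1"
    then have b1: "b = 1" using b(1) by simp
    have sq: "qj (qj q) = qi (qi q)" for q by (simp add: qi_qj_square)
    have "\<exists>q\<in>S3. F q \<bullet> e3 q = 0 \<and> F q \<bullet> e1 q = 0"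
      by (rule common_zero[OF S qi_qj_continuous(2) qi_qj_S3(2) qi_qj_continuous(1) qi_qj_S3(1) sq cont(3,1)])
        (auto simp: a(2) b(2) b1 \<open>a = -1\<close> frame_qi frame_qj)
    then show False using no_zero by blast
  qed
  ultimately show ?thesis
    using F a(2) b(2) by (intro exI[of _ F]) simp
qed

text \<open>
  The plane orthogonal to \<open>F\<close> has the frame \<open>e1 \<times> F\<close>, \<open>F \<times> (e1 \<times> F)\<close>, because \<open>F\<close> is never parallel to
  \<open>e1\<close>. The functions \<open>u\<close> and \<open>v\<close> below are the inner products of \<open>F \<times> G\<close> with it; for the second one
  use \<open>F \<times> (e1 \<times> F) = e1 - (F \<bullet> e1) F\<close> and that \<open>F \<times> G\<close> is orthogonal to \<open>F\<close>. As \<open>F \<times> G\<close> is unchanged by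
  \<open>qi\<close> and \<open>qj\<close>, the signs of \<open>u\<close> and \<open>v\<close> come from \<open>e1\<close> and \<open>F\<close> alone; they are both negative under
  the product \<open>qk\<close> of \<open>qi\<close> and \<open>qj\<close>.
\<close>

lemma no_two_further_lines:
  assumes f: "continuous_map (top_of_set S3) RP2 f" and g: "continuous_map (top_of_set S3) RP2 g"
    and f1: "\<And>q. q \<in> S3 \<Longrightarrow> f q \<noteq> {e1 q, - e1 q}" and f2: "\<And>q. q \<in> S3 \<Longrightarrow> f q \<noteq> {e2 q, - e2 q}"
    and g1: "\<And>q. q \<in> S3 \<Longrightarrow> g q \<noteq> {e1 q, - e1 q}" and g2: "\<And>q. q \<in> S3 \<Longrightarrow> g q \<noteq> {e2 q, - e2 q}"
    and fg: "\<And>q. q \<in> S3 \<Longrightarrow> f q \<noteq> g q"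
    and finv: "\<And>q. q \<in> S3 \<Longrightarrow> f (qi q) = f q" "\<And>q. q \<in> S3 \<Longrightarrow> f (qj q) = f q"
    and ginv: "\<And>q. q \<in> S3 \<Longrightarrow> g (qi q) = g q" "\<And>q. q \<in> S3 \<Longrightarrow> g (qj q) = g q"
  shows False
proof -
  note S = S3_topology
  have "\<exists>F. continuous_on S3 F \<and>
    (\<forall>q\<in>S3. norm (F q) = 1 \<and> f q = {F q, - F q} \<and> F (qi q) = - F q \<and> F (qj q) = - F q)"
    by (rule antisymmetric_lift[OF f]) (simp_all add: f1 f2 finv)
  then obtain F where F: "continuous_on S3 F" "\<And>q. q \<in> S3 \<Longrightarrow> norm (F q) = 1" "\<And>q. q \<in> S3 \<Longrightarrow> f q = {F q, - F q}"
    "\<And>q. q \<in> S3 \<Longrightarrow> F (qi q) = - F q" "\<And>q. q \<in> S3 \<Longrightarrow> F (qj q) = - F q"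
    by blast
  have "\<exists>F. continuous_on S3 F \<and>
    (\<forall>q\<in>S3. norm (F q) = 1 \<and> g q = {F q, - F q} \<and> F (qi q) = - F q \<and> F (qj q) = - F q)"
    by (rule antisymmetric_lift[OF g]) (simp_all add: g1 g2 ginv)
  then obtain G where G: "continuous_on S3 G" "\<And>q. q \<in> S3 \<Longrightarrow> norm (G q) = 1" "\<And>q. q \<in> S3 \<Longrightarrow> g q = {G q, - G q}"
    "\<And>q. q \<in> S3 \<Longrightarrow> G (qi q) = - G q" "\<And>q. q \<in> S3 \<Longrightarrow> G (qj q) = - G q"
    by blast
  have inS: "qi q \<in> S3" "qj q \<in> S3" if "q \<in> S3" for q
    using that qi_qj_S3 by auto
  define u where "u q = cross3 (e1 q) (F q) \<bullet> cross3 (F q) (G q)" for q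
  define v where "v q = e1 q \<bullet> cross3 (F q) (G q)" for q
  have cont: "continuous_on S3 u" "continuous_on S3 v"
    unfolding u_def v_def by (intro continuous_intros continuous_on_cross F(1) G(1) frame_continuous)+
  have sym: "u (qi q) = - u q" "u (qj q) = u q" "v (qi q) = v q" "v (qj q) = - v q" if "q \<in> S3" for q
    using that by (simp_all add: u_def v_def F G frame_qi frame_qj)
  define qk where "qk q = qj (qi q)" for q
  have qk: "continuous_on S3 qk" "qk \<in> S3 \<rightarrow> S3"
    unfolding qk_def using inS
    by (auto intro!: continuous_on_compose2[OF qi_qj_continuous(2)[of UNIV]] qi_qj_continuous)
  have sq: "qk (qk q) = qj (qj q)" for q
    by (simp add: qk_def qi_qj_square)
  have "\<exists>q\<in>S3. u q = 0 \<and> v q = 0"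
    by (rule common_zero[OF S qk qi_qj_continuous(2) qi_qj_S3(2) sq cont])
      (auto simp: qk_def sym inS)
  then obtain q where q: "q \<in> S3" "v q = 0" "u q = 0"
    by blast
  define w where "w = cross3 (F q) (G q)"
  have "cross3 w (cross3 (e1 q) (F q)) = 0"
    using q(2) by (simp add: Lagrange w_def v_def inner_commute dot_cross_self)
  moreover have "w \<bullet> cross3 (e1 q) (F q) = 0"
    using q(3) by (simp add: w_def u_def inner_commute)
  ultimately have "w = 0 \<or> cross3 (e1 q) (F q) = 0"
    using norm_and_cross_eq_0 by blast
  then show False
  proof
    assume "w = 0"
    then show False
      using cross3_unit_eq_0[OF F(2)[OF q(1)] G(2)[OF q(1)]] fg[OF q(1)] F(3) G(3) q(1) by (auto simp: w_def)
  next
    assume "cross3 (e1 q) (F q) = 0"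
    then show False
      using cross3_unit_eq_0[OF frame_orthonormal(1)[OF q(1)] F(2)[OF q(1)]] f1[OF q(1)] F(3) q(1) by auto
  qed
qed

section \<open>Cross-sections over orthonormal frames\<close>

definition frame_lines :: "nat \<Rightarrow> complex \<times> complex \<Rightarrow> nat \<Rightarrow> (real^3) set" where
  "frame_lines n q = (\<lambda>k\<in>{1..n}. let e = (if k = 1 then e1 q else if k = 2 then e2 q else e3 q) in {e, - e})"

lemma frame_lines_invariant: "frame_lines n (qi q) = frame_lines n q" "frame_lines n (qj q) = frame_lines n q"
  by (rule ext; simp add: frame_lines_def frame_qi frame_qj Let_def insert_commute)+

lemma continuous_map_to_RP2:
  assumes "continuous_on S e" "\<And>q. q \<in> S \<Longrightarrow> norm (e q) = 1"
  shows "continuous_map (top_of_set S) RP2 (\<lambda>q. {e q, - e q})"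
proof -
  have "continuous_map (top_of_set S) (top_of_set (sphere 0 1)) e"
    using assms by (simp add: continuous_map_in_subtopology Pi_iff)
  moreover have "continuous_map (top_of_set (sphere 0 1)) RP2 (\<lambda>x. {x, - x})"
    unfolding RP2_def by (rule quotient_imp_continuous_map[OF quotient_map_quotient_topology])
  ultimately show ?thesis
    by (rule continuous_map_compose[unfolded o_def])
qed

lemma continuous_frame_lines:
  assumes "n \<le> 3"
  shows "continuous_map (top_of_set S3) (config_space n RP2) (frame_lines n)"
proof -
  have lines: "continuous_map (top_of_set S3) RP2 (\<lambda>q. {e1 q, - e1 q})"
    "continuous_map (top_of_set S3) RP2 (\<lambda>q. {e2 q, - e2 q})"
    "continuous_map (top_of_set S3) RP2 (\<lambda>q. {e3 q, - e3 q})"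
    by (intro continuous_map_to_RP2 frame_continuous frame_orthonormal; assumption)+
  have "continuous_map (top_of_set S3) RP2 (\<lambda>q. frame_lines n q k)" if "k \<in> {1..n}" for k
    using that lines by (cases "k = 1"; cases "k = 2") (simp_all add: frame_lines_def Let_def)
  then have "continuous_map (top_of_set S3) (product_topology (\<lambda>_. RP2) {1..n}) (frame_lines n)"
    by (auto simp: continuous_map_componentwise frame_lines_def)
  moreover have "frame_lines n q i \<noteq> frame_lines n q j"
    if "q \<in> S3" "i \<in> {1..n}" "j \<in> {1..n}" "i \<noteq> j" for q i j
  proof -
    note on = frame_orthonormal[OF that(1)]
    have sq: "e1 q \<bullet> e1 q = 1" "e2 q \<bullet> e2 q = 1" "e3 q \<bullet> e3 q = 1"
      using on by (simp_all add: dot_square_norm)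
    have neq: "{x, - x} \<noteq> {y, - y}" if "x \<bullet> x = 1" "x \<bullet> y = 0" for x y :: "real^3"
      using that by (auto simp: doubleton_eq_iff)
    have "i = 1 \<or> i = 2 \<or> i = 3" "j = 1 \<or> j = 2 \<or> j = 3"
      using that assms by auto
    then show ?thesis
      using that neq[OF sq(1) on(4)] neq[OF sq(1) on(5)] neq[OF sq(2) on(6)]
      by (auto simp: frame_lines_def Let_def)
  qed
  ultimately show ?thesis
    by (auto simp: config_space_def continuous_map_in_subtopology)
qed

text \<open>
  Over triples the third component of the cross-section is the line of \<open>e3\<close>, over pairs it is an unknown
  line; in both cases the third and fourth components are two further lines depending only on the
  frame lines, which are the same for \<open>q\<close>, \<open>qi q\<close> and \<open>qj q\<close>.
\<close>

lemma no_cross_section: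
  assumes n: "n = 2 \<or> n = 3" and m: "m \<ge> 4"
  shows "\<not> cross_section (config_space m RP2) (config_space n RP2) (config_proj n) s"
proof
  assume s: "cross_section (config_space m RP2) (config_space n RP2) (config_proj n) s"
  define c where "c q = s (frame_lines n q)" for q
  have frame: "continuous_map (top_of_set S3) (config_space n RP2) (frame_lines n)"
    using n by (intro continuous_frame_lines) auto
  have cont: "continuous_map (top_of_set S3) (config_space m RP2) c"
    using continuous_map_compose[OF frame, of _ s] s by (simp add: cross_section_def c_def[abs_def] o_def)
  have comp: "continuous_map (top_of_set S3) RP2 (\<lambda>q. c q k)" if "k \<in> {1..m}" for k
    using cont that by (auto simp: config_space_def continuous_map_in_subtopology continuous_map_componentwise)
  have inj: "c q i \<noteq> c q j" if "q \<in> S3" "i \<in> {1..m}" "j \<in> {1..m}" "i \<noteq> j" for q i j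
  proof -
    have "c q \<in> topspace (config_space m RP2)"
      using continuous_map_funspace[OF cont] that(1) by auto
    then show ?thesis
      using that(2-4) by (simp add: topspace_config_space)
  qed
  have sect: "config_proj n (c q) = frame_lines n q" if "q \<in> S3" for q
  proof -
    have "frame_lines n q \<in> topspace (config_space n RP2)"
      using continuous_map_funspace[OF frame] that by auto
    then show ?thesis
      using s by (simp add: cross_section_def c_def)
  qed
  have c12: "c q 1 = {e1 q, - e1 q}" "c q 2 = {e2 q, - e2 q}" if "q \<in> S3" for q
    using fun_cong[OF sect[OF that], of 1] fun_cong[OF sect[OF that], of 2] n
    by (auto simp: config_proj_def frame_lines_def Let_def)
  have inv: "c (qi q) = c q" "c (qj q) = c q" for q
    by (simp_all add: c_def frame_lines_invariant)
  show False
  proof (rule no_two_further_lines[of "\<lambda>q. c q 3" "\<lambda>q. c q 4"])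
    fix q assume q: "q \<in> S3"
    show "c q 3 \<noteq> {e1 q, - e1 q}" "c q 3 \<noteq> {e2 q, - e2 q}" "c q 4 \<noteq> {e1 q, - e1 q}"
      "c q 4 \<noteq> {e2 q, - e2 q}" "c q 3 \<noteq> c q 4"
      using inj[OF q] m by (simp_all flip: c12[OF q])
  qed (use m inv comp in auto)
qed

theorem theorem2:
  fixes m :: nat
  assumes "m \<ge> 4"
  shows "(\<nexists>s. cross_section (config_space m RP2) (config_space 2 RP2) (config_proj 2) s) \<and>
         (\<nexists>s. cross_section (config_space m RP2) (config_space 3 RP2) (config_proj 3) s)"
  using no_cross_section assms by blast

end
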